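(* For every integer $n\ge 1$, the length of the left side of the Harter–Heighway dragon curve $\mathcal C_n$, that is, the number of horizontal and vertical unit line segments on the left side of $\mathcal C_n$, equals $a_{n-1}$, where the integers $a_k$ are defined by the Taylor expansion about $x=0$ $$\frac{2(1+x^2)}{(1-x)(1-x-2x^3)}=\sum_{k=0}^{\infty}a_kx^k=2+4x+8x^2+16x^3+28x^4+48x^5+84x^6+\cdots.$$ (For $n=0$ the left side of $\mathcal C_0$ consists of $1$ segment.)
   Context: The dragon curves $\mathcal C_n$ are defined via an L-system and turtle geometry. Let $\Omega=\{A,B,+,-\}$ and let $P$ be the substitution $P(A)=A+B$, $P(B)=A-B$, $P(+)=+$, $P(-)=-$, extended letterwise to words. $\mathcal C_n$ is the lattice path in $\mathbb Z^2$ starting at $(0,0)$ obtained by reading the word $P^n(A)$ letter by letter, where $A$ means a horizontal unit move, $B$ a vertical unit move (each move continuing in the current heading), $+$ a $90^\circ$ clockwise turn without moving and $-$ a $90^\circ$ counterclockwise turn without moving; the initial heading is horizontal. Thus $\mathcal C_n$ consists of $2^n$ unit edges, with a right angle between consecutive edges. Since $\mathcal C_n$ has distinct start and end points, its boundary has a left side and a right side (relative to traversal from start to end). Equivalently the boundary is that of the polyomino $\mathcal S_n$, the union of the squares having as a diagonal an edge of $\mathcal C_n$; by earlier work, the left side of the boundary of $\mathcal S_n$ is traced (self-avoidingly) by the word $P_1^n(\mathtt R)$ of the L-system on $\{\mathtt R,\mathtt r,\mathtt L,\mathtt l,\mathtt S,\mathtt s\}$ with $\mathtt R\mapsto\mathtt{Rr}$,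 $\mathtt r\mapsto\mathtt S$, $\mathtt L\mapsto\mathtt S$, $\mathtt l\mapsto\mathtt{Ll}$, $\mathtt S\mapsto\mathtt{Rl}$, $\mathtt s\mapsto\mathtt{Lr}$ (letters $\mathtt R/\mathtt r$: right turn mid-edge, $\mathtt L/\mathtt l$: left turn, $\mathtt S/\mathtt s$: no turn; uppercase starts at an even lattice point, lowercase at an odd one). *)

theory Defs
  imports "HOL-Analysis.Analysis" "HOL-Computational_Algebra.Formal_Power_Series"
begin

datatype sym = A | B | Pl | Mi

fun subst :: "sym \<Rightarrow> sym list" where
  "subst A = [A, Pl, B]"
| "subst B = [A, Mi, B]"
| "subst Pl = [Pl]"
| "subst Mi = [Mi]"

definition subst_word :: "sym list \<Rightarrow> sym list" where
  "subst_word w = concat (map subst w)"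

definition dragon_word :: "nat \<Rightarrow> sym list" where
  "dragon_word n = (subst_word ^^ n) [A]"

definition turn_cw :: "int \<times> int \<Rightarrow> int \<times> int" where
  "turn_cw d = (snd d, - fst d)"

definition turn_ccw :: "int \<times> int \<Rightarrow> int \<times> int" where
  "turn_ccw d = (- snd d, fst d)"

fun turtle :: "int \<times> int \<Rightarrow> int \<times> int \<Rightarrow> sym list \<Rightarrow> (int \<times> int) list" where
  "turtle p d [] = [p]"
| "turtle p d (A # w) = p # turtle (fst p + fst d, snd p + snd d) d w"
| "turtle p d (B # w) = p # turtle (fst p + fst d, snd p + snd d) d w"
| "turtle p d (Pl # w) = turtle p (turn_cw d) w"
| "turtle p d (Mi # w) = turtle p (turn_ccw d) w"

definition dragon_pts :: "nat \<Rightarrow> (int \<times> int) list" where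
  "dragon_pts n = turtle (0, 0) (1, 0) (dragon_word n)"

definition rpt :: "int \<times> int \<Rightarrow> real \<times> real" where
  "rpt p = (real_of_int (fst p), real_of_int (snd p))"

definition dragon_edge :: "nat \<Rightarrow> nat \<Rightarrow> (real \<times> real) set" where
  "dragon_edge n i = closed_segment (rpt (dragon_pts n ! i)) (rpt (dragon_pts n ! Suc i))"

definition dragon_set :: "nat \<Rightarrow> (real \<times> real) set" where
  "dragon_set n = (\<Union>i < length (dragon_pts n) - 1. dragon_edge n i)"

(* centre of the unit lattice square lying immediately to the left of the i-th edge
   (left with respect to the direction of traversal) *)
definition left_cell_centre :: "nat \<Rightarrow> nat \<Rightarrow> real \<times> real" where
  "left_cell_centre n i =
     (let (px, py) = rpt (dragon_pts n ! i); (qx, qy) = rpt (dragon_pts n ! Suc i)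
      in ((px + qx) / 2 - (qy - py) / 2, (py + qy) / 2 + (qx - px) / 2))"

(* the unit segments of C_n lying on the left side of its boundary: those edges
   whose left-hand side faces the unbounded complementary region *)
definition left_side :: "nat \<Rightarrow> (real \<times> real) set set" where
  "left_side n = {dragon_edge n i | i. i < length (dragon_pts n) - 1 \<and>
                    left_cell_centre n i \<in> outside (dragon_set n)}"

definition left_length :: "nat \<Rightarrow> nat" where
  "left_length n = card (left_side n)"

definition dragon_gf :: "real fps" where
  "dragon_gf = fps_const 2 * (1 + fps_X ^ 2) / ((1 - fps_X) * (1 - fps_X - fps_const 2 * fps_X ^ 3))"

end

theory Submission
  imports Defs
begin

text \<open>
  The dragon curve traverses horizontal grid edges from even to odd lattice points and vertical ones
  from odd to even points. Hence the left side of a traversed edge depends only on the edge, and the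
  cells with an even lower left corner are exactly the cells lying to the left of all four of their
  sides. Such a cell lies outside the curve iff one of its four sides is not traversed: the untraversed
  edges are all connected to each other by steps between perpendicular edges with a common end point,
  since the substitution preserves this relation and the lattice minus one edge is connected. So the
  left side has \<open>2 ^ n - 4 * F n\<close> segments, where \<open>F n\<close> counts the left cells whose four sides are all
  traversed. After one substitution each left cell arises from one old cell, and a prescribed set
  of its sides is traversed iff certain sides of the old cell are; this gives linear recurrences
  for \<open>F\<close>.
\<close>

datatype side = South | East | North | West

definition rot :: "int \<times> int \<Rightarrow> int \<times> int" where
  "rot z = (fst z + snd z, snd z - fst z)"

text \<open>
  The edge \<open>(z, k)\<close> is the side \<open>k\<close> of the cell with lower left corner \<open>rot z\<close>, which is \<open>(1 - i) z\<close> in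
  complex notation; \<open>rot\<close> maps the plane lattice onto the even lattice points, and every edge is the side
  of exactly one such cell.
\<close>

type_synonym edge = "(int \<times> int) \<times> side"

fun side_start :: "side \<Rightarrow> int \<times> int" where
  "side_start South = (0, 0)"
| "side_start East = (1, 0)"
| "side_start North = (1, 1)"
| "side_start West = (0, 1)"

fun side_dir :: "side \<Rightarrow> int \<times> int" where
  "side_dir South = (1, 0)"
| "side_dir East = (0, 1)"
| "side_dir North = (-1, 0)"
| "side_dir West = (0, -1)"

text \<open>Every side is oriented counterclockwise around its cell, which thus lies on its left;
  horizontal sides start at even lattice points and vertical ones at odd points.\<close>

definition arrow :: "edge \<Rightarrow> (int \<times> int) \<times> (int \<times> int)" where
  "arrow e = (rot (fst e) + side_start (snd e), side_dir (snd e))"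

fun children :: "edge \<Rightarrow> edge set" where
  "children (z, South) = {(rot z, South), (rot z + (1, 0), West)}"
| "children (z, East) = {(rot z + (1, 0), South), (rot z + (1, 0), East)}"
| "children (z, North) = {(rot z + (1, 0), North), (rot z, East)}"
| "children (z, West) = {(rot z, North), (rot z, West)}"

text \<open>
  The curve of order \<open>n + 1\<close> is the one of order \<open>n\<close> multiplied by \<open>1 - i\<close>, each edge being replaced by
  two legs of a right isosceles triangle; so \<open>rot\<close> also occurs as the map on cell indices.
\<close>

primrec edges :: "nat \<Rightarrow> edge set" where
  "edges 0 = {((0, 0), South)}"
| "edges (Suc n) = \<Union> (children ` edges n)"

subsection \<open>Edges traversed by the turtle\<close>

fun arrows :: "int \<times> int \<Rightarrow> int \<times> int \<Rightarrow> sym list \<Rightarrow> ((int \<times> int) \<times> (int \<times> int)) list" where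
  "arrows p d [] = []"
| "arrows p d (A # w) = (p, d) # arrows (p + d) d w"
| "arrows p d (B # w) = (p, d) # arrows (p + d) d w"
| "arrows p d (Pl # w) = arrows p (turn_cw d) w"
| "arrows p d (Mi # w) = arrows p (turn_ccw d) w"

lemma hd_turtle: "turtle p d w \<noteq> [] \<and> turtle p d w ! 0 = p"
  by (induction p d w rule: turtle.induct) auto

lemma length_turtle: "length (turtle p d w) = Suc (length (arrows p d w))"
  by (induction p d w rule: arrows.induct) (auto simp: plus_prod_def)

lemma turtle_nth:
  assumes "i < length (arrows p d w)"
  shows "turtle p d w ! i = fst (arrows p d w ! i)"
    and "turtle p d w ! Suc i = fst (arrows p d w ! i) + snd (arrows p d w ! i)"
proof -
  have "turtle p d w ! i = fst (arrows p d w ! i) \<and>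
        turtle p d w ! Suc i = fst (arrows p d w ! i) + snd (arrows p d w ! i)"
    using assms
  proof (induction p d w arbitrary: i rule: arrows.induct)
    case (2 p d w)
    then show ?case using hd_turtle[of "p + d" d w]
      by (cases i) (auto simp: plus_prod_def)
  next
    case (3 p d w)
    then show ?case using hd_turtle[of "p + d" d w]
      by (cases i) (auto simp: plus_prod_def)
  qed auto
  then show "turtle p d w ! i = fst (arrows p d w ! i)"
    and "turtle p d w ! Suc i = fst (arrows p d w ! i) + snd (arrows p d w ! i)" by auto
qed

text \<open>In \<open>alternating h b w\<close>, \<open>h\<close> says that the current heading is horizontal and \<open>b\<close> that
  the next move is an \<open>A\<close>.\<close>

fun alternating :: "bool \<Rightarrow> bool \<Rightarrow> sym list \<Rightarrow> bool" where
  "alternating h b [] = True"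
| "alternating h b (A # w) = (h \<and> b \<and> alternating True False w)"
| "alternating h b (B # w) = (\<not> h \<and> \<not> b \<and> alternating False True w)"
| "alternating h b (Pl # w) = alternating (\<not> h) b w"
| "alternating h b (Mi # w) = alternating (\<not> h) b w"

lemma subst_word_Cons [simp]: "subst_word (x # w) = subst x @ subst_word w"
  and subst_word_Nil [simp]: "subst_word [] = []"
  by (simp_all add: subst_word_def)

text \<open>Every image block starts with \<open>A\<close>, hence the flag \<open>True\<close>. Its
  heading is the old one before an \<open>A\<close> and turned by a right angle before a
  \<open>B\<close>, so it is horizontal iff \<open>h = b\<close>.\<close>

lemma alternating_subst_word:
  "alternating h b w \<Longrightarrow> alternating (h = b) True (subst_word w)"
proof (induction h b w rule: alternating.induct)
  case (4 h b w)
  then show ?case by (cases b) auto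
next
  case (5 h b w)
  then show ?case by (cases b) auto
qed auto

lemma alternating_dragon_word: "alternating True True (dragon_word n)"
proof (induction n)
  case (Suc n)
  then show ?case using alternating_subst_word[of True True "dragon_word n"]
    by (simp add: dragon_word_def)
qed (simp add: dragon_word_def)

text \<open>The legs \<open>d\<close> and \<open>turn_cw d\<close> add up to \<open>rot d\<close>. A
  horizontal arrow (letter \<open>A\<close>) takes them in this order, a vertical one (letter
  \<open>B\<close>) in the reverse order.\<close>

definition arrow_children ::
    "(int \<times> int) \<times> (int \<times> int) \<Rightarrow> ((int \<times> int) \<times> (int \<times> int)) set" where
  "arrow_children a = (case a of (q, d) \<Rightarrow>
     if snd d = 0 then {(rot q, d), (rot q + d, turn_cw d)}
     else {(rot q, turn_cw d), (rot q + turn_cw d, d)})"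

text \<open>Relative to the old heading, the image of an \<open>A\<close> sets out unturned and that
  of a \<open>B\<close> turned clockwise, so the initial heading depends on the next letter.\<close>

lemma arrows_subst_word:
  assumes "alternating h b w" "h \<longleftrightarrow> snd d = 0" "(snd d = 0) \<noteq> (fst d = 0)"
  shows "set (arrows (rot p) (if b then d else turn_cw d) (subst_word w)) =
         \<Union> (arrow_children ` set (arrows p d w))"
  using assms
proof (induction h b w arbitrary: p d rule: alternating.induct)
  case (2 h b w)
  have "rot p + d + turn_cw d = rot (p + d)"
    by (simp add: rot_def turn_cw_def prod_eq_iff)
  with 2 show ?case by (auto simp: arrow_children_def)
next
  case (3 h b w)
  have eq: "rot p + turn_cw d + d = rot (p + d)" "turn_ccw (turn_cw d) = d"
    by (simp_all add: rot_def turn_cw_def turn_ccw_def prod_eq_iff)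
  from 3 show ?case by (auto simp: arrow_children_def eq)
next
  case (4 h b w)
  from "4.IH"[of "turn_cw d" p] "4.prems" show ?case
    by (cases b) (auto simp: turn_cw_def)
next
  case (5 h b w)
  have eq: "turn_ccw (turn_cw d) = turn_cw (turn_ccw d)"
    "snd (turn_ccw d) = fst d" "fst (turn_ccw d) = - snd d"
    by (simp_all add: turn_cw_def turn_ccw_def)
  from "5.IH"[of "turn_ccw d" p] "5.prems" show ?case
    by (cases b) (auto simp: eq)
qed auto

lemma arrow_children_arrow: "arrow_children (arrow e) = arrow ` children e"
proof (cases e)
  case (Pair z k)
  then show ?thesis
    by (cases k) (auto simp: arrow_children_def arrow_def rot_def turn_cw_def)
qed

lemma set_arrows_dragon_word:
  "set (arrows (0, 0) (1, 0) (dragon_word n)) = arrow ` edges n"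
proof (induction n)
  case 0
  show ?case by (simp add: dragon_word_def arrow_def rot_def)
next
  case (Suc n)
  have "set (arrows (0, 0) (1, 0) (dragon_word (Suc n))) =
        \<Union> (arrow_children ` set (arrows (0, 0) (1, 0) (dragon_word n)))"
    using arrows_subst_word[OF alternating_dragon_word[of n], of "(1, 0)" "(0, 0)"]
    by (simp add: dragon_word_def rot_def)
  also have "\<dots> = (\<Union>e \<in> edges n. arrow_children (arrow e))"
    by (simp add: Suc)
  also have "\<dots> = arrow ` edges (Suc n)"
    by (simp add: arrow_children_arrow image_Union)
  finally show ?case .
qed

section \<open>Traversed edges as plane segments\<close>

definition segment :: "edge \<Rightarrow> (real \<times> real) set" where
  "segment e = closed_segment (rpt (fst (arrow e))) (rpt (fst (arrow e) + snd (arrow e)))"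

definition centre :: "int \<times> int \<Rightarrow> real \<times> real" where
  "centre z = rpt (rot z) + (1 / 2, 1 / 2)"

lemma dragon_edge_arrow:
  assumes "i < length (arrows (0, 0) (1, 0) (dragon_word n))"
    and "arrows (0, 0) (1, 0) (dragon_word n) ! i = arrow e"
  shows "dragon_edge n i = segment e" "left_cell_centre n i = centre (fst e)"
proof -
  have p: "dragon_pts n ! i = fst (arrow e)"
    "dragon_pts n ! Suc i = fst (arrow e) + snd (arrow e)"
    using turtle_nth[OF assms(1)] assms(2) by (simp_all add: dragon_pts_def)
  show "dragon_edge n i = segment e"
    by (simp add: dragon_edge_def segment_def p)
  show "left_cell_centre n i = centre (fst e)"
    by (cases e, cases "snd e")
       (simp_all add: left_cell_centre_def p rpt_def centre_def arrow_def Let_def field_simps)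
qed

lemma length_dragon_pts:
  "length (dragon_pts n) = Suc (length (arrows (0, 0) (1, 0) (dragon_word n)))"
  by (simp add: dragon_pts_def length_turtle)

lemma dragon_edges_nth:
  assumes "i < length (dragon_pts n) - 1"
  obtains e where "e \<in> edges n" "dragon_edge n i = segment e"
    "left_cell_centre n i = centre (fst e)"
proof -
  have i: "i < length (arrows (0, 0) (1, 0) (dragon_word n))"
    using assms by (simp add: length_dragon_pts)
  then obtain e where "e \<in> edges n" "arrows (0, 0) (1, 0) (dragon_word n) ! i = arrow e"
    using set_arrows_dragon_word[of n] nth_mem[OF i] by auto
  then show thesis
    using that dragon_edge_arrow[OF i] by blast
qed

lemma edge_is_dragon_edge:
  assumes "e \<in> edges n"
  obtains i where "i < length (dragon_pts n) - 1" "dragon_edge n i = segment e"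
    "left_cell_centre n i = centre (fst e)"
proof -
  have "arrow e \<in> set (arrows (0, 0) (1, 0) (dragon_word n))"
    using assms set_arrows_dragon_word by blast
  then obtain i where i: "i < length (arrows (0, 0) (1, 0) (dragon_word n))"
    "arrows (0, 0) (1, 0) (dragon_word n) ! i = arrow e"
    by (auto simp: in_set_conv_nth)
  then show thesis
    using that dragon_edge_arrow[OF i] by (simp add: length_dragon_pts)
qed

lemma dragon_set_eq: "dragon_set n = \<Union> (segment ` edges n)"
  unfolding dragon_set_def by (blast elim: dragon_edges_nth edge_is_dragon_edge)

lemma left_side_eq:
  "left_side n = segment ` {e \<in> edges n. centre (fst e) \<in> outside (\<Union> (segment ` edges n))}"
proof -
  have "left_side n = segment ` {e \<in> edges n. centre (fst e) \<in> outside (dragon_set n)}"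
  proof (intro equalityI subsetI)
    fix s assume "s \<in> left_side n"
    then obtain i where i: "i < length (dragon_pts n) - 1" "s = dragon_edge n i"
      "left_cell_centre n i \<in> outside (dragon_set n)"
      unfolding left_side_def by blast
    from dragon_edges_nth[OF i(1)] obtain e where "e \<in> edges n" "dragon_edge n i = segment e"
      "left_cell_centre n i = centre (fst e)" .
    with i show "s \<in> segment ` {e \<in> edges n. centre (fst e) \<in> outside (dragon_set n)}"
      by simp
  next
    fix s assume "s \<in> segment ` {e \<in> edges n. centre (fst e) \<in> outside (dragon_set n)}"
    then obtain e where e: "e \<in> edges n" "s = segment e" "centre (fst e) \<in> outside (dragon_set n)"
      by blast
    from edge_is_dragon_edge[OF e(1)] obtain i where "i < length (dragon_pts n) - 1"
      "dragon_edge n i = segment e" "left_cell_centre n i = centre (fst e)" .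
    with e show "s \<in> left_side n"
      unfolding left_side_def by (intro CollectI exI[of _ i]) simp
  qed
  then show ?thesis
    unfolding dragon_set_eq .
qed

subsection \<open>Adjacency of untraversed edges\<close>

text \<open>Perpendicular edges with a common end point, each pair once: the first four rules are
  the corners of a left cell, the last four those of the other cells.\<close>

inductive adjacent :: "edge \<Rightarrow> edge \<Rightarrow> bool" where
  "adjacent (z, South) (z, East)"
| "adjacent (z, East) (z, North)"
| "adjacent (z, North) (z, West)"
| "adjacent (z, West) (z, South)"
| "adjacent (z, East) (z + (1, 0), North)"
| "adjacent (z, East) (z + (0, 1), South)"
| "adjacent (z, North) (z + (0, 1), West)"
| "adjacent (z, South) (z + (1, 0), West)"

text \<open>Both ends of each step avoid \<open>S\<close>, but by reflexivity an edge in
  \<open>S\<close> is still linked to itself; hence the separate assumption below that the first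
  edge is untraversed.\<close>

definition linked :: "edge set \<Rightarrow> edge \<Rightarrow> edge \<Rightarrow> bool" where
  "linked S = (\<lambda>e e'. (adjacent e e' \<or> adjacent e' e) \<and> e \<notin> S \<and> e' \<notin> S)\<^sup>*\<^sup>*"

lemma linked_refl [simp]: "linked S e e"
  by (simp add: linked_def)

lemma linked_trans [trans]: "linked S a b \<Longrightarrow> linked S b c \<Longrightarrow> linked S a c"
  by (simp add: linked_def)

lemma linked_sym: "linked S a b \<Longrightarrow> linked S b a"
  unfolding linked_def
  by (rule sympD[OF symp_rtranclp]) (auto intro: sympI)

lemma linked_adjacent: "adjacent a b \<Longrightarrow> a \<notin> S \<Longrightarrow> b \<notin> S \<Longrightarrow> linked S a b"
  by (auto simp: linked_def)

lemma rot_simps: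
  "rot z = rot z' \<longleftrightarrow> z = z'" "rot z \<noteq> rot z' + (1, 0)" "rot z + (1, 0) \<noteq> rot z'"
proof -
  show "rot z = rot z' \<longleftrightarrow> z = z'"
    by (auto simp: rot_def prod_eq_iff)
  have "rot z \<noteq> rot z' + (1, 0)" for z z'
    unfolding rot_def by (simp; presburger)
  then show "rot z \<noteq> rot z' + (1, 0)" "rot z + (1, 0) \<noteq> rot z'" by metis+
qed

lemma rot_cases:
  obtains z where "w = rot z" | z where "w = rot z + (1, 0)"
proof (cases "even (fst w + snd w)")
  case True
  then have "w = rot ((fst w - snd w) div 2, (fst w + snd w) div 2)"
    unfolding rot_def prod_eq_iff by (simp; presburger)
  then show thesis by (rule that(1))
next
  case False
  then have "w = rot ((fst w - 1 - snd w) div 2, (fst w - 1 + snd w) div 2) + (1, 0)"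
    unfolding rot_def prod_eq_iff by (simp; presburger)
  then show thesis by (rule that(2))
qed

text \<open>Each edge is a child of exactly one edge, by the parity of its cell index; the eight
  equivalences read off that parent.\<close>

lemma edges_Suc_simps:
  "(rot z, South) \<in> edges (Suc n) \<longleftrightarrow> (z, South) \<in> edges n"
  "(rot z, East) \<in> edges (Suc n) \<longleftrightarrow> (z, North) \<in> edges n"
  "(rot z, North) \<in> edges (Suc n) \<longleftrightarrow> (z, West) \<in> edges n"
  "(rot z, West) \<in> edges (Suc n) \<longleftrightarrow> (z, West) \<in> edges n"
  "(rot z + (1, 0), South) \<in> edges (Suc n) \<longleftrightarrow> (z, East) \<in> edges n"
  "(rot z + (1, 0), East) \<in> edges (Suc n) \<longleftrightarrow> (z, East) \<in> edges n"
  "(rot z + (1, 0), North) \<in> edges (Suc n) \<longleftrightarrow> (z, North) \<in> edges n"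
  "(rot z + (1, 0), West) \<in> edges (Suc n) \<longleftrightarrow> (z, South) \<in> edges n"
proof -
  have *: "(w, k) \<in> edges (Suc n) \<longleftrightarrow> (\<exists>z.
      (z, South) \<in> edges n \<and> (w, k) \<in> children (z, South) \<or>
      (z, East) \<in> edges n \<and> (w, k) \<in> children (z, East) \<or>
      (z, North) \<in> edges n \<and> (w, k) \<in> children (z, North) \<or>
      (z, West) \<in> edges n \<and> (w, k) \<in> children (z, West))" for w k
  proof -
    have "(w, k) \<in> edges (Suc n) \<longleftrightarrow> (\<exists>z j. (z, j) \<in> edges n \<and> (w, k) \<in> children (z, j))"
      by auto
    moreover have "(\<exists>j. P j) \<longleftrightarrow> P South \<or> P East \<or> P North \<or> P West" for P
      by (metis side.exhaust)
    ultimately show ?thesis by (simp only:)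
  qed
  show
    "(rot z, South) \<in> edges (Suc n) \<longleftrightarrow> (z, South) \<in> edges n"
    "(rot z, East) \<in> edges (Suc n) \<longleftrightarrow> (z, North) \<in> edges n"
    "(rot z, North) \<in> edges (Suc n) \<longleftrightarrow> (z, West) \<in> edges n"
    "(rot z, West) \<in> edges (Suc n) \<longleftrightarrow> (z, West) \<in> edges n"
    "(rot z + (1, 0), South) \<in> edges (Suc n) \<longleftrightarrow> (z, East) \<in> edges n"
    "(rot z + (1, 0), East) \<in> edges (Suc n) \<longleftrightarrow> (z, East) \<in> edges n"
    "(rot z + (1, 0), North) \<in> edges (Suc n) \<longleftrightarrow> (z, North) \<in> edges n"
    "(rot z + (1, 0), West) \<in> edges (Suc n) \<longleftrightarrow> (z, South) \<in> edges n"
    unfolding * by (auto simp: rot_simps simp del: split_paired_Ex)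
qed

text \<open>By uniqueness of parents, children of untraversed edges are untraversed too, so links
  can be carried through the substitution.\<close>

lemma child_in_edges_Suc:
  assumes "c \<in> children e"
  shows "c \<in> edges (Suc n) \<longleftrightarrow> e \<in> edges n"
proof (cases e)
  case (Pair z k)
  with assms show ?thesis
    by (cases k) (auto simp: edges_Suc_simps simp del: edges.simps)
qed

lemma child_exists: obtains e where "c \<in> children e"
proof (cases c)
  case (Pair w k)
  have "(rot z, k) \<in> children (z, South) \<union> children (z, North) \<union> children (z, West)"
    "(rot z + (1, 0), k) \<in> children (z, South) \<union> children (z, East) \<union> children (z, North)" for z
    by (cases k; simp)+
  then show thesis
    using Pair that by (metis UnE rot_cases)
qed

lemma siblings_adjacent:
  assumes "c \<in> children e" "c' \<in> children e"
  shows "c = c' \<or> adjacent c c' \<or> adjacent c' c"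
proof (cases e)
  case (Pair z k)
  with assms show ?thesis
    by (cases k) (auto intro: adjacent.intros)
qed

text \<open>At the image of the common end point both edges have a child, and these are again
  perpendicular: a horizontal edge has a horizontal leg at its even end and a vertical one at its
  odd end, a vertical edge conversely.\<close>

lemma adjacent_children:
  assumes "adjacent e e'"
  obtains c c' where "c \<in> children e" "c' \<in> children e'" "adjacent c c' \<or> adjacent c' c"
proof -
  have rots: "rot (z + (1, 0)) = rot z + (1, -1)" "rot (z + (0, 1)) = rot z + (1, 0) + (0, 1)" for z
    by (simp_all add: rot_def prod_eq_iff)
  \<comment> \<open>Brings the positions of the children into the offset form of the rules for
    \<open>adjacent\<close>.\<close>
  have shift: "rot z + (1, 0) = (rot z + (1, -1)) + (0, 1)" for z
    by (simp add: prod_eq_iff)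
  have "\<exists>c \<in> children e. \<exists>c' \<in> children e'. adjacent c c' \<or> adjacent c' c"
    using assms
  proof cases
    case (5 z)
    have "adjacent (rot z + (1, -1), East) (rot z + (1, 0), South)"
      unfolding shift by (rule adjacent.intros)
    with 5 show ?thesis by (auto simp: rots)
  next
    case (6 z)
    have "adjacent (rot z + (1, 0), East) (rot z + (1, 0) + (0, 1), South)"
      by (rule adjacent.intros)
    with 6 show ?thesis by (auto simp: rots simp del: add_Pair)
  next
    case (7 z)
    have "adjacent (rot z + (1, 0), North) (rot z + (1, 0) + (0, 1), West)"
      by (rule adjacent.intros)
    with 7 show ?thesis by (auto simp: rots simp del: add_Pair)
  next
    case (8 z)
    have "adjacent (rot z + (1, -1), North) (rot z + (1, 0), West)"
      unfolding shift by (rule adjacent.intros)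
    with 8 show ?thesis by (auto simp: rots)
  qed (auto intro: adjacent.intros)
  then show thesis using that by blast
qed

lemma linked_children:
  assumes "linked (edges n) e e'" "e \<notin> edges n" "c \<in> children e" "c' \<in> children e'"
  shows "linked (edges (Suc n)) c c'"
proof -
  have sib: "linked (edges (Suc n)) a b"
    if "a \<in> children x" "b \<in> children x" "x \<notin> edges n" for a b x
  proof -
    have "a \<notin> edges (Suc n)" "b \<notin> edges (Suc n)"
      using that child_in_edges_Suc by blast+
    then show ?thesis
      using siblings_adjacent[OF that(1,2)] linked_adjacent linked_sym linked_refl by blast
  qed
  \<comment> \<open>Strengthened to all children of the current edge, so that any of them can
    continue the chain.\<close>
  have "e' \<notin> edges n \<and> (\<forall>c' \<in> children e'. linked (edges (Suc n)) c c')"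
    using assms(1)[unfolded linked_def]
  proof (induction rule: rtranclp_induct)
    case base
    then show ?case using sib assms by blast
  next
    case (step x y)
    obtain a b where ab: "a \<in> children x" "b \<in> children y" "adjacent a b \<or> adjacent b a"
      using step.hyps(2) adjacent_children by metis
    have xy: "x \<notin> edges n" "y \<notin> edges n"
      using step.hyps(2) by auto
    have "a \<notin> edges (Suc n)" "b \<notin> edges (Suc n)"
      using ab xy child_in_edges_Suc by blast+
    then have "linked (edges (Suc n)) a b"
      using ab(3) linked_adjacent linked_sym by blast
    then have "linked (edges (Suc n)) c b"
      using step.IH ab(1) linked_trans by blast
    then show ?case
      using sib[OF ab(2) _ xy(2)] xy(2) linked_trans by blast
  qed
  then show ?thesis using assms(4) by blast
qed

text \<open>At order 0 the lattice lacks a single edge; afterwards untraversed edges have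
  untraversed parents, whose links descend to the children.\<close>

lemma linked_edges:
  assumes "e \<notin> edges n" "e' \<notin> edges n"
  shows "linked (edges n) e e'"
  using assms
proof (induction n arbitrary: e e')
  case 0
  let ?L = "linked (edges 0)"
  \<comment> \<open>\<open>North\<close> sides serve as hubs: they are never traversed at order 0,
    each untraversed side is linked to the one of its cell, and neighbouring hubs are
    linked.\<close>
  have face: "?L (z, k) (z, North)" if "(z, k) \<notin> edges 0" for z k
  proof -
    have 1: "?L (z, East) (z, North)" "?L (z, West) (z, North)"
      by (auto intro: linked_adjacent linked_sym adjacent.intros)
    moreover have "?L (z, South) (z, East)" if "(z, South) \<notin> edges 0"
      using that by (intro linked_adjacent adjacent.intros) auto
    ultimately show ?thesis using that linked_trans linked_refl by (cases k) metis+
  qed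
  have right: "?L (z, North) (z + (1, 0), North)" for z
    using linked_trans[OF linked_sym[OF face[of z East]] linked_adjacent[OF adjacent.intros(5)]]
    by simp
  have up: "?L (z, North) (z + (0, 1), North)" for z
    using linked_trans[OF linked_adjacent[OF adjacent.intros(7)] face[of "z + (0, 1)" West]]
    by simp
  have row: "?L ((0, y), North) ((x, y), North)" for x y
  proof (induction x rule: int_induct[where k = 0])
    case (step1 i)
    show ?case using linked_trans[OF step1(2) right] by simp
  next
    case (step2 i)
    show ?case
      using linked_trans[OF step2(2), of "((i - 1, y), North)"] linked_sym[OF right[of "(i - 1, y)"]]
      by simp
  qed simp
  have col: "?L ((0, 0), North) ((0, y), North)" for y
  proof (induction y rule: int_induct[where k = 0])
    case (step1 i)
    show ?case using linked_trans[OF step1(2) up] by simp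
  next
    case (step2 i)
    show ?case
      using linked_trans[OF step2(2), of "((0, i - 1), North)"] linked_sym[OF up[of "(0, i - 1)"]]
      by simp
  qed simp
  have "?L ((0, 0), North) e" if "e \<notin> edges 0" for e
    using col[of "snd (fst e)"] row[of "snd (fst e)" "fst (fst e)"] face[of "fst e" "snd e"] that
      linked_trans linked_sym by (metis prod.collapse)
  with 0 show ?case using linked_trans linked_sym by metis
next
  case (Suc n)
  obtain x y where "e \<in> children x" "e' \<in> children y"
    using child_exists by metis
  with Suc show ?case
    using linked_children child_in_edges_Suc by metis
qed

lemma finite_edges: "finite (edges n)"
proof -
  have "finite (children e)" for e
    by (cases e rule: children.cases) auto
  then show ?thesis by (induction n) auto
qed


subsection \<open>Untraversed edges lead to infinity\<close>

definition midpt :: "edge \<Rightarrow> real \<times> real" where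
  "midpt e = midpoint (rpt (fst (arrow e))) (rpt (fst (arrow e) + snd (arrow e)))"

lemma closed_segment_horizontal:
  fixes a b y :: real
  shows "closed_segment (a, y) (b, y) = closed_segment a b \<times> {y}"
proof -
  have "(1 - u) * y + u * y = y" for u by (simp add: left_diff_distrib)
  then show ?thesis by (auto simp: closed_segment_def)
qed

lemma closed_segment_vertical:
  fixes a b x :: real
  shows "closed_segment (x, a) (x, b) = {x} \<times> closed_segment a b"
proof -
  have "(1 - u) * x + u * x = x" for u by (simp add: left_diff_distrib)
  then show ?thesis by (auto simp: closed_segment_def)
qed

lemma segment_simps:
  "segment ((x, y), South) = {real_of_int (x + y)..real_of_int (x + y + 1)} \<times> {real_of_int (y - x)}"
  "segment ((x, y), East) = {real_of_int (x + y + 1)} \<times> {real_of_int (y - x)..real_of_int (y - x + 1)}"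
  "segment ((x, y), North) = {real_of_int (x + y)..real_of_int (x + y + 1)} \<times> {real_of_int (y - x + 1)}"
  "segment ((x, y), West) = {real_of_int (x + y)} \<times> {real_of_int (y - x)..real_of_int (y - x + 1)}"
  by (simp_all add: segment_def arrow_def rot_def rpt_def closed_segment_horizontal
      closed_segment_vertical closed_segment_eq_real_ivl algebra_simps)

lemma midpt_simps:
  "midpt ((x, y), South) = (real_of_int (x + y) + 1 / 2, real_of_int (y - x))"
  "midpt ((x, y), East) = (real_of_int (x + y + 1), real_of_int (y - x) + 1 / 2)"
  "midpt ((x, y), North) = (real_of_int (x + y) + 1 / 2, real_of_int (y - x + 1))"
  "midpt ((x, y), West) = (real_of_int (x + y), real_of_int (y - x) + 1 / 2)"
  by (simp_all add: midpt_def arrow_def rot_def rpt_def midpoint_def field_simps)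

lemma of_int_half_iff:
  fixes a b :: int
  shows "real_of_int a \<le> real_of_int b + 1 / 2 \<longleftrightarrow> a \<le> b"
    and "real_of_int b + 1 / 2 \<le> real_of_int a \<longleftrightarrow> b < a"
    and "real_of_int a \<noteq> real_of_int b + 1 / 2"
    and "real_of_int b + 1 / 2 \<noteq> real_of_int a"
proof -
  show le: "real_of_int a \<le> real_of_int b + 1 / 2 \<longleftrightarrow> a \<le> b"
    "real_of_int b + 1 / 2 \<le> real_of_int a \<longleftrightarrow> b < a" by linarith+
  then show "real_of_int a \<noteq> real_of_int b + 1 / 2" "real_of_int b + 1 / 2 \<noteq> real_of_int a"
    by (metis order.refl not_less)+
qed

lemma segment_coords:
  assumes "(u, v) \<in> segment e"
  shows "u \<in> \<int> \<or> v \<in> \<int>"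
proof -
  obtain x y k where "e = ((x, y), k)" by (metis prod.collapse)
  with assms show ?thesis
    by (cases k) (auto simp: segment_simps simp del: of_int_add of_int_diff)
qed

text \<open>A midpoint has one integer and one half-integer coordinate; the former fixes the grid
  line, the latter the unit segment on it.\<close>

lemma midpt_in_segment:
  assumes "midpt e \<in> segment e'"
  shows "e = e'"
proof -
  obtain x y k x' y' k' where e: "e = ((x, y), k)" "e' = ((x', y'), k')" by (metis prod.collapse)
  have "x = x' \<and> y = y' \<and> k = k'"
    using assms unfolding e
    by (cases k; cases k'; simp add: segment_simps midpt_simps of_int_half_iff
        del: of_int_add of_int_diff; presburger)
  then show ?thesis by (simp add: e)
qed

lemma midpt_in_own_segment: "midpt e \<in> segment e"
  by (simp add: midpt_def segment_def)

lemma inj_segment: "inj segment"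
  by (rule injI) (metis midpt_in_own_segment midpt_in_segment)

lemma Ints_not_between:
  assumes "real_of_int a < u" "u < real_of_int a + 1"
  shows "u \<notin> \<int>"
proof
  assume "u \<in> \<int>"
  then obtain c where "u = real_of_int c" by (rule Ints_cases)
  with assms have "real_of_int a < real_of_int c" "real_of_int c < real_of_int (a + 1)" by simp_all
  then show False by (simp only: of_int_less_iff)
qed

definition curve :: "edge set \<Rightarrow> (real \<times> real) set" where
  "curve S = \<Union> (segment ` S)"

text \<open>The bounds on the sums put the midpoint of \<open>p\<close> and \<open>q\<close> in the
  open cell, so that these points, possibly on its boundary, do not share a side.\<close>

definition across_cell :: "int \<Rightarrow> int \<Rightarrow> real \<times> real \<Rightarrow> real \<times> real \<Rightarrow> bool" where
  "across_cell a b p q \<longleftrightarrow>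
     {fst p, fst q} \<subseteq> {real_of_int a..real_of_int a + 1} \<and>
     {snd p, snd q} \<subseteq> {real_of_int b..real_of_int b + 1} \<and>
     fst p + fst q \<in> {2 * real_of_int a<..<2 * real_of_int a + 2} \<and>
     snd p + snd q \<in> {2 * real_of_int b<..<2 * real_of_int b + 2}"

text \<open>Apart from its end points, the segment from \<open>p\<close> to \<open>q\<close> lies in
  the open cell, which no edge meets.\<close>

lemma connected_across_cell:
  assumes "p \<notin> curve S" "q \<notin> curve S" and cell: "across_cell a b p q"
  shows "connected_component (- curve S) p q"
proof -
  have strict: "c < (1 - t) * u + t * v"
    if "c \<le> u" "c \<le> v" "2 * c < u + v" "0 < t" "t < 1" for c u v t :: real
  proof -
    have "0 \<le> (1 - t) * (u - c)" "0 \<le> t * (v - c)" using that by auto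
    moreover have "0 < (1 - t) * (u - c) \<or> 0 < t * (v - c)"
      using that by (smt (verit) mult_pos_pos)
    ultimately have "0 < (1 - t) * (u - c) + t * (v - c)" by linarith
    then show ?thesis by (simp add: algebra_simps)
  qed
  have "closed_segment p q \<subseteq> - curve S"
  proof
    fix r assume "r \<in> closed_segment p q"
    then obtain t where t: "0 \<le> t" "t \<le> 1" "r = (1 - t) *\<^sub>R p + t *\<^sub>R q"
      by (auto simp: closed_segment_def)
    show "r \<in> - curve S"
    proof (cases "t = 0 \<or> t = 1")
      case True
      with t assms show ?thesis by auto
    next
      case False
      with t have t': "0 < t" "t < 1" by auto
      have "a < fst r" "b < snd r"
        using strict[of a "fst p" "fst q" t] strict[of b "snd p" "snd q" t] t t' cell
        by (auto simp: across_cell_def)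
      \<comment> \<open>Upper bounds are lower bounds for the negated coordinates.\<close>
      moreover have "fst r < a + 1" "snd r < b + 1"
        using strict[of "- (a + 1)" "- fst p" "- fst q" t] strict[of "- (b + 1)" "- snd p" "- snd q" t]
          t t' cell by (auto simp: across_cell_def)
      ultimately have "fst r \<notin> \<int>" "snd r \<notin> \<int>"
        using Ints_not_between by auto
      then show ?thesis
        unfolding curve_def using segment_coords by (metis ComplI UN_E prod.collapse)
    qed
  qed
  then show ?thesis
    unfolding connected_component_def by (intro exI[of _ "closed_segment p q"]) auto
qed

lemma midpt_notin_curve: "e \<notin> S \<Longrightarrow> midpt e \<notin> curve S"
  by (auto simp: curve_def dest: midpt_in_segment)

text \<open>The edges are sides of one cell: the left cell of \<open>z\<close> in the first four
  cases, its right, upper or lower neighbour in the others.\<close>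

lemma connected_adjacent:
  assumes "adjacent e e'" "e \<notin> S" "e' \<notin> S"
  shows "connected_component (- curve S) (midpt e) (midpt e')"
proof -
  have "\<exists>a b. across_cell a b (midpt e) (midpt e')"
    using assms(1)
  proof cases
    case (1 z)
    then have "across_cell (fst (rot z)) (snd (rot z)) (midpt e) (midpt e')"
      by (cases z) (simp add: across_cell_def midpt_simps rot_def)
    then show ?thesis by blast
  next
    case (2 z)
    then have "across_cell (fst (rot z)) (snd (rot z)) (midpt e) (midpt e')"
      by (cases z) (simp add: across_cell_def midpt_simps rot_def)
    then show ?thesis by blast
  next
    case (3 z)
    then have "across_cell (fst (rot z)) (snd (rot z)) (midpt e) (midpt e')"
      by (cases z) (simp add: across_cell_def midpt_simps rot_def)
    then show ?thesis by blast
  next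
    case (4 z)
    then have "across_cell (fst (rot z)) (snd (rot z)) (midpt e) (midpt e')"
      by (cases z) (simp add: across_cell_def midpt_simps rot_def)
    then show ?thesis by blast
  next
    case (5 z)
    then have "across_cell (fst (rot z) + 1) (snd (rot z)) (midpt e) (midpt e')"
      by (cases z) (simp add: across_cell_def midpt_simps rot_def)
    then show ?thesis by blast
  next
    case (6 z)
    then have "across_cell (fst (rot z) + 1) (snd (rot z)) (midpt e) (midpt e')"
      by (cases z) (simp add: across_cell_def midpt_simps rot_def)
    then show ?thesis by blast
  next
    case (7 z)
    then have "across_cell (fst (rot z)) (snd (rot z) + 1) (midpt e) (midpt e')"
      by (cases z) (simp add: across_cell_def midpt_simps rot_def)
    then show ?thesis by blast
  next
    case (8 z)
    then have "across_cell (fst (rot z)) (snd (rot z) - 1) (midpt e) (midpt e')"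
      by (cases z) (simp add: across_cell_def midpt_simps rot_def)
    then show ?thesis by blast
  qed
  then show ?thesis
    using connected_across_cell[OF assms(2,3)[THEN midpt_notin_curve]] by blast
qed

lemma connected_linked:
  assumes "linked S e e'" "e \<notin> S"
  shows "connected_component (- curve S) (midpt e) (midpt e')"
  using assms(1)[unfolded linked_def]
proof (induction rule: rtranclp_induct)
  case base
  then show ?case using assms(2) midpt_notin_curve by simp
next
  case (step x y)
  then have "connected_component (- curve S) (midpt x) (midpt y)"
    using connected_adjacent connected_component_sym by blast
  with step.IH show ?case by (rule connected_component_trans)
qed

lemma centre_notin_curve: "centre z \<notin> curve S"
proof -
  have "fst (centre z) \<notin> \<int>" "snd (centre z) \<notin> \<int>"
    by (rule Ints_not_between[of "fst (rot z)"]; simp add: centre_def rpt_def)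
       (rule Ints_not_between[of "snd (rot z)"]; simp add: centre_def rpt_def)
  then show ?thesis
    unfolding curve_def using segment_coords by (metis UN_E prod.collapse)
qed

lemma connected_centre:
  assumes "(z, k) \<notin> S"
  shows "connected_component (- curve S) (centre z) (midpt (z, k))"
proof (rule connected_across_cell[OF centre_notin_curve midpt_notin_curve[OF assms]])
  show "across_cell (fst (rot z)) (snd (rot z)) (centre z) (midpt (z, k))"
    by (cases z; cases k; simp add: across_cell_def centre_def rpt_def midpt_simps rot_def)
qed

text \<open>The component of the centre contains all untraversed midpoints, and only finitely many
  edges are traversed, so it is unbounded.\<close>

lemma centre_outside:
  assumes "(z, k) \<notin> edges n"
  shows "centre z \<in> outside (curve (edges n))"
proof -
  let ?C = "connected_component_set (- curve (edges n)) (centre z)"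
  have mid: "midpt e \<in> ?C" if "e \<notin> edges n" for e
    using connected_component_trans[OF connected_centre[OF assms]
        connected_linked[OF linked_edges[OF assms that] assms]] by simp
  have "\<not> bounded ?C"
  proof
    assume "bounded ?C"
    then obtain r where r: "\<And>p. p \<in> ?C \<Longrightarrow> norm p \<le> r"
      unfolding bounded_iff by blast
    \<comment> \<open>These sides have midpoints with first coordinate
      \<open>2 * m + 1 / 2\<close>.\<close>
    define far where "far = (\<lambda>m :: nat. ((int m, int m), South))"
    have "finite (far -` edges n)"
      using finite_edges by (rule finite_vimageI) (auto simp: far_def inj_def)
    moreover have "infinite {nat \<lceil>r\<rceil><..}"
      by (rule infinite_Ioi)
    ultimately have "\<not> {nat \<lceil>r\<rceil><..} \<subseteq> far -` edges n"
      using finite_subset by blast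
    then obtain m where "nat \<lceil>r\<rceil> < m" "far m \<notin> edges n" by auto
    then have m: "r < real m" "far m \<notin> edges n" by linarith+
    have "real m \<le> fst (midpt (far m))" by (simp add: far_def midpt_simps)
    also have "\<dots> \<le> norm (midpt (far m))"
      using norm_fst_le[of "fst (midpt (far m))" "snd (midpt (far m))"] by simp
    also have "\<dots> \<le> r" using r[OF mid[OF m(2)]] .
    finally show False using m(1) by simp
  qed
  then show ?thesis
    using centre_notin_curve by (simp add: outside_def)
qed

text \<open>The boundary of the cell belongs to the curve, which traps the component of the centre
  in the closed cell.\<close>

lemma centre_not_outside:
  assumes "\<And>k. (z, k) \<in> S"
  shows "centre z \<notin> outside (curve S)"
proof -
  obtain x y where z: "z = (x, y)" by fastforce
  define Q where "Q = {real_of_int (x + y)..x + y + 1} \<times> {real_of_int (y - x)..y - x + 1}"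
  define I where "I = {real_of_int (x + y)<..<x + y + 1} \<times> {real_of_int (y - x)<..<y - x + 1}"
  let ?C = "connected_component_set (- curve S) (centre z)"
  have "closed Q" "bounded Q"
    unfolding Q_def by (auto intro: closed_Times bounded_Times)
  have "open I" "I \<subseteq> Q"
    unfolding I_def Q_def by (auto intro: open_Times)
  have "frontier Q \<subseteq> Q - I"
    using \<open>closed Q\<close> interior_maximal[OF \<open>I \<subseteq> Q\<close> \<open>open I\<close>]
    by (auto simp: frontier_def)
  also have "\<dots> \<subseteq> segment (z, South) \<union> segment (z, East) \<union> segment (z, North) \<union> segment (z, West)"
    unfolding z segment_simps Q_def I_def by auto
  also have "\<dots> \<subseteq> curve S"
    using assms by (auto simp: curve_def)
  finally have "?C \<inter> frontier Q = {}"
    using connected_component_subset[of "- curve S" "centre z"] by blast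
  moreover have "centre z \<in> ?C \<inter> Q"
    using centre_notin_curve by (auto simp: z Q_def centre_def rpt_def rot_def)
  ultimately have "?C \<subseteq> Q"
    using connected_Int_frontier[OF connected_connected_component, of "- curve S" "centre z" Q] by blast
  then show ?thesis
    using \<open>bounded Q\<close> bounded_subset by (auto simp: outside_def)
qed

lemma left_side_eq_not_full:
  "left_side n = segment ` {e \<in> edges n. \<exists>k. (fst e, k) \<notin> edges n}"
proof -
  have "centre z \<in> outside (curve (edges n)) \<longleftrightarrow> (\<exists>k. (z, k) \<notin> edges n)" for z
    using centre_outside centre_not_outside by blast
  then show ?thesis
    by (simp add: left_side_eq curve_def)
qed

subsection \<open>Counting\<close>

text \<open>Sides outside \<open>K\<close> are unrestricted, which keeps the recurrences linear. For
  empty \<open>K\<close> the set is infinite and \<open>card\<close> returns 0.\<close>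

definition pattern_count :: "nat \<Rightarrow> side set \<Rightarrow> nat" where
  "pattern_count n K = card {z. \<forall>k \<in> K. (z, k) \<in> edges n}"

text \<open>The side \<open>k\<close> of the cell \<open>rot z\<close> (of the cell \<open>rot z + (1, 0)\<close>) comes from the side \<open>parent_even k\<close>
  (\<open>parent_odd k\<close>) of the cell \<open>z\<close>.\<close>

fun parent_even :: "side \<Rightarrow> side" where
  "parent_even South = South"
| "parent_even East = North"
| "parent_even North = West"
| "parent_even West = West"

fun parent_odd :: "side \<Rightarrow> side" where
  "parent_odd South = East"
| "parent_odd East = East"
| "parent_odd North = North"
| "parent_odd West = South"

lemma edges_Suc_parent:
  "(rot z, k) \<in> edges (Suc n) \<longleftrightarrow> (z, parent_even k) \<in> edges n"
  "(rot z + (1, 0), k) \<in> edges (Suc n) \<longleftrightarrow> (z, parent_odd k) \<in> edges n"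
  by (cases k; simp add: edges_Suc_simps del: edges.simps)+

lemma finite_pattern: "K \<noteq> {} \<Longrightarrow> finite {z. \<forall>k \<in> K. (z, k) \<in> edges n}"
  by (rule finite_subset[of _ "fst ` edges n"]) (force simp: finite_edges)+

text \<open>Cells split by parity into \<open>rot z\<close> and \<open>rot z + (1, 0)\<close>, and a
  side of either is traversed iff its parent side of \<open>z\<close> is.\<close>

lemma pattern_count_Suc:
  assumes "K \<noteq> {}"
  shows "pattern_count (Suc n) K =
    pattern_count n (parent_even ` K) + pattern_count n (parent_odd ` K)"
proof -
  let ?E = "{z. \<forall>k \<in> parent_even ` K. (z, k) \<in> edges n}"
  let ?O = "{z. \<forall>k \<in> parent_odd ` K. (z, k) \<in> edges n}"
  have "w \<in> {w. \<forall>k \<in> K. (w, k) \<in> edges (Suc n)} \<longleftrightarrow> w \<in> rot ` ?E \<union> (\<lambda>z. rot z + (1, 0)) ` ?O" for w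
    by (rule rot_cases[of w])
       (auto simp: edges_Suc_parent image_iff rot_simps simp del: edges.simps)
  then have "{w. \<forall>k \<in> K. (w, k) \<in> edges (Suc n)} = rot ` ?E \<union> (\<lambda>z. rot z + (1, 0)) ` ?O"
    by blast
  moreover have "rot ` ?E \<inter> (\<lambda>z. rot z + (1, 0)) ` ?O = {}"
    by (auto simp: rot_simps)
  moreover have "inj rot" "inj (\<lambda>z. rot z + (1, 0))"
    by (auto intro!: injI simp: rot_simps)
  moreover have "finite ?E" "finite ?O"
    by (rule finite_pattern, simp add: assms)+
  ultimately show ?thesis
    by (simp add: pattern_count_def card_Un_disjoint card_image inj_on_subset[OF _ subset_UNIV])
qed

lemma pattern_count_0:
  assumes "k \<in> K" "k \<noteq> South"
  shows "pattern_count 0 K = 0"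
proof -
  have "{z. \<forall>k \<in> K. (z, k) \<in> edges 0} = {}"
    using assms by auto
  then show ?thesis by (simp only: pattern_count_def card.empty)
qed

lemma UNIV_side: "UNIV = {South, East, North, West}"
  using side.exhaust by blast

lemma finite_side: "finite (UNIV :: side set)"
  by (simp add: UNIV_side)

text \<open>Each side occurs exactly twice among the values of \<open>parent_even\<close> and
  \<open>parent_odd\<close>, so one substitution doubles the sum.\<close>

lemma pattern_count_singletons:
  "pattern_count n {South} + pattern_count n {East} + pattern_count n {North} +
   pattern_count n {West} = 2 ^ n"
proof (induction n)
  case 0
  show ?case by (simp add: pattern_count_def)
next
  case (Suc n)
  then show ?case by (simp add: pattern_count_Suc)
qed

lemma card_edges: "card (edges n) = 2 ^ n"
proof -
  have "edges n = prod.swap ` (SIGMA k:UNIV. {z. (z, k) \<in> edges n})"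
    by (force simp: image_iff)
  moreover have "finite {z. (z, k) \<in> edges n}" for k
    using finite_pattern[of "{k}" n] by simp
  moreover have "card (prod.swap ` (SIGMA k:UNIV. {z. (z, k) \<in> edges n})) =
      card (SIGMA k:UNIV. {z. (z, k) \<in> edges n})"
    by (rule card_image) (rule inj_swap)
  ultimately have "card (edges n) = (\<Sum>k \<in> UNIV. card {z. (z, k) \<in> edges n})"
    by (subst (asm) card_SigmaI) (simp_all add: UNIV_side)
  then show ?thesis
    using pattern_count_singletons[of n] by (simp add: UNIV_side pattern_count_def)
qed

text \<open>The traversed edges not on the left side are the sides of the fully traversed cells,
  four for each.\<close>

lemma left_length_eq: "left_length n + 4 * pattern_count n UNIV = 2 ^ n"
proof -
  let ?F = "{z. \<forall>k \<in> UNIV. (z, k) \<in> edges n}"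
  have fin: "finite ?F" by (rule finite_pattern) simp
  have "left_length n = card {e \<in> edges n. \<exists>k. (fst e, k) \<notin> edges n}"
    unfolding left_length_def left_side_eq_not_full
    by (rule card_image) (rule inj_on_subset[OF inj_segment subset_UNIV])
  moreover have "card ({e \<in> edges n. \<exists>k. (fst e, k) \<notin> edges n} \<union> ?F \<times> UNIV) =
      card {e \<in> edges n. \<exists>k. (fst e, k) \<notin> edges n} + card (?F \<times> (UNIV :: side set))"
    using fin finite_edges[of n] finite_side by (intro card_Un_disjoint) auto
  moreover have "{e \<in> edges n. \<exists>k. (fst e, k) \<notin> edges n} \<union> ?F \<times> UNIV = edges n"
    by auto
  ultimately have "card (edges n) = left_length n + card (?F \<times> (UNIV :: side set))"
    by simp
  moreover have "card (?F \<times> (UNIV :: side set)) = 4 * pattern_count n UNIV"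
    unfolding card_cartesian_product pattern_count_def by (simp add: UNIV_side)
  ultimately show ?thesis by (simp add: card_edges)
qed

text \<open>The sums over the two mirror-image patterns satisfy a smaller system of recurrences than the
  individual counts.\<close>

definition three_sided :: "nat \<Rightarrow> nat" where
  "three_sided n = pattern_count n {South, North, West} + pattern_count n {South, East, North}"

definition even_corners :: "nat \<Rightarrow> nat" where
  "even_corners n = pattern_count n {South, West} + pattern_count n {East, North}"

lemma pattern_count_UNIV_Suc: "pattern_count (Suc n) UNIV = three_sided n"
  by (simp add: pattern_count_Suc UNIV_side three_sided_def insert_commute)

lemma three_sided_Suc: "three_sided (Suc n) = three_sided n + even_corners n"
  by (simp add: pattern_count_Suc three_sided_def even_corners_def insert_commute)

text \<open>The pairs in \<open>even_corners\<close> meet at even points. They lead to themselves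
  and to the pairs at odd corners; these lead to \<open>{South, North}\<close> and to singletons,
  and \<open>{South, North}\<close> leads back to \<open>even_corners\<close>. The singletons
  contribute \<open>2 ^ n\<close>.\<close>

lemma even_corners_Suc3:
  "even_corners (Suc (Suc (Suc n))) = even_corners (Suc (Suc n)) + 2 * even_corners n + 2 ^ n"
  using pattern_count_singletons[of n]
  by (simp add: pattern_count_Suc even_corners_def insert_commute)

text \<open>The initial curve is one \<open>South\<close> side, so every pattern with another side
  has count 0 at order 0.\<close>

lemma initial_counts:
  "three_sided 0 = 0" "even_corners 0 = 0" "even_corners (Suc 0) = 0" "even_corners (Suc (Suc 0)) = 0"
  by (simp_all add: three_sided_def even_corners_def pattern_count_Suc insert_commute
      pattern_count_0[of East] pattern_count_0[of North] pattern_count_0[of West])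

section \<open>Generating function\<close>

lemma left_length_Suc: "real (left_length (Suc n)) = 2 * 2 ^ n - 4 * real (three_sided n)"
  using arg_cong[OF left_length_eq[of "Suc n"], of real] by (simp add: pattern_count_UNIV_Suc)

text \<open>Multiplying the series by the denominator turns the claim into a linear recurrence of
  order 4 with four initial values.\<close>

lemma dragon_gf_eq: "dragon_gf = Abs_fps (\<lambda>k. real (left_length (Suc k)))"
proof -
  define t where "t = (\<lambda>k. real (left_length (Suc k)))"
  define f where "f = Abs_fps t"
  define D :: "real fps" where "D = (1 - fps_X) * (1 - fps_X - fps_const 2 * fps_X ^ 3)"
  \<comment> \<open>The form \<open>fps_X ^ 1\<close> lets the coefficient rule for powers of
    \<open>fps_X\<close> apply to every term.\<close>
  have D: "D = 1 - fps_X ^ 1 - fps_X ^ 1 + fps_X ^ 2 - fps_const 2 * fps_X ^ 3 + fps_const 2 * fps_X ^ 4"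
    unfolding D_def by (simp add: algebra_simps eval_nat_numeral del: fps_const_mult)
  have fD: "f * D = f - f * fps_X ^ 1 - f * fps_X ^ 1 + f * fps_X ^ 2 - fps_const 2 * (f * fps_X ^ 3)
      + fps_const 2 * (f * fps_X ^ 4)"
    unfolding D by (simp only: algebra_simps mult_1_left mult_1_right)
  have nth: "fps_nth (f * D) k = t k - 2 * (if k < 1 then 0 else t (k - 1)) +
      (if k < 2 then 0 else t (k - 2)) - 2 * (if k < 3 then 0 else t (k - 3)) +
      2 * (if k < 4 then 0 else t (k - 4))" for k
    unfolding fD unfolding fps_add_nth fps_sub_nth fps_mult_left_const_nth fps_X_power_mult_right_nth f_def
    by simp
  have t: "t 0 = 2" "t 1 = 4" "t 2 = 8" "t 3 = 16"
    by (simp_all add: t_def left_length_Suc three_sided_Suc even_corners_Suc3 initial_counts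
        numeral_eq_Suc)
  \<comment> \<open>Starts at index 4, the degree of \<open>D\<close>; the numerator has degree 2
    and affects only the coefficients checked by hand.\<close>
  have rec: "t (m + 4) = 2 * t (m + 3) - t (m + 2) + 2 * t (m + 1) - 2 * t m" for m
    by (simp add: t_def left_length_Suc three_sided_Suc even_corners_Suc3 numeral_eq_Suc)
  have "fps_nth (f * D) k = fps_nth (fps_const 2 * (1 + fps_X ^ 2)) k" for k
  proof -
    consider "k = 0" | "k = 1" | "k = 2" | "k = 3" | m where "k = m + 4"
    proof -
      have "k = 0 \<or> k = 1 \<or> k = 2 \<or> k = 3 \<or> (\<exists>m. k = m + 4)" by presburger
      then show thesis using that by blast
    qed
    then show ?thesis
      unfolding nth by cases (use t in \<open>simp_all add: rec add.commute fps_X_power_nth\<close>)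
  qed
  then have "f * D = fps_const 2 * (1 + fps_X ^ 2)"
    by (rule fps_ext)
  moreover have "D \<noteq> 0"
  proof
    assume "D = 0"
    moreover have "fps_nth D 0 = 1" by (simp add: D_def)
    ultimately show False by simp
  qed
  ultimately have "dragon_gf = f"
    unfolding dragon_gf_def D_def[symmetric] by (metis nonzero_mult_div_cancel_right)
  then show ?thesis by (simp add: f_def t_def)
qed

theorem theorem1:
  fixes n :: nat
  assumes "n \<ge> 1"
  shows "real (left_length n) = fps_nth dragon_gf (n - 1)"
  using assms by (simp add: dragon_gf_eq)

end
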